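(* Let $A=RB:I\to\mathbb{R}^{3\times6}$ be smooth on an open interval $I$, with columns linearly independent over $\mathbb{R}$ (as functions on $I$), where $R(t)\in SO(3)$ and $$B=\begin{pmatrix}\ell_1b_{12}&b_{12}&b_{13}&\ell_2b_{15}&b_{15}&\ell_1b_{15}+b_{13}/\ell_2\\0&0&b_{23}&\ell_2b_{25}&b_{25}&\ell_1b_{25}+b_{23}/\ell_2\\0&0&-1/(b_{12}b_{25})&0&0&-1/(\ell_2b_{12}b_{25})\end{pmatrix},$$ with $b_{12},b_{25},\ell_2$ nowhere zero. Suppose that $Q_{12},Q_{13},Q_{14},Q_{25},Q_{23},Q_{24},Q_{35},Q_{36},Q_{45},Q_{46},Q_{56}$ are constant, $Q_{ij}=c_{ij}$, that $Q_{15}-Q_{26}$ is constant, and that $\ell_1=k_2\ell_2+k_1+k_0/\ell_2$ for real constants $k_0,k_1,k_2$ with $k_2k_0\ne0$. Then $R$ is constant and there are constants $k_3,k_4$ such that $$(\ell_2')^3=\frac{k_3\ell_2^4}{k_0-k_2\ell_2^2},\qquad \ell_1=k_2\ell_2+k_1+\frac{k_0}{\ell_2},\qquad b_{25}^6=\frac{c_{45}^3(k_0-k_2\ell_2^2)}{k_3\ell_2^4},$$ $$b_{13}=b_{15}=0,\qquad b_{23}=(k_4\ell_2-k_0)b_{25},\qquad b_{12}^2=-\frac{c_{12}\,b_{25}^2\,\ell_2^2}{c_{45}(k_0-k_2\ell_2^2)} .$$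
   Context: For $A(t)\in\mathbb{R}^{3\times m}$ with columns $A_i$, $Q_{ij}=\langle A_i',A_j\rangle-\langle A_j',A_i\rangle$, $'=d/dt$. Origin: $\varphi(z,t)=A(t)v(z)$ is sought as a solution of the 3D incompressible Euler equations in Lagrangian form with $v=(z_1,z_2,z_3,f_1(z_3),z_2f_3'(z_1)+f_2(z_1),f_3(z_1))$ (parabolic case, $m=6$). The form $$B=\begin{pmatrix}\ell_1b_{12}&b_{12}&b_{13}&\ell_2b_{15}&b_{15}&\ell_1b_{15}+b_{13}/\ell_2\\0&0&b_{23}&\ell_2b_{25}&b_{25}&\ell_1b_{25}+b_{23}/\ell_2\\0&0&-1/(b_{12}b_{25})&0&0&-1/(\ell_2b_{12}b_{25})\end{pmatrix}$$ corresponds to the determinant conditions $p_{123}=p_{356}=p_{135}-p_{236}=p_{124}=p_{456}=p_{245}=0$, $p_{235}=p_{145}-p_{246}=1$, $p_{125}=p_{345}=0$, where $p_{ijk}=\det(A_i,A_j,A_k)$; here $A_1=\ell_1A_2$, $A_4=\ell_2A_5$, $A_6=A_3/\ell_2+\ell_1A_5$. The relation $\ell_1=k_2\ell_2+k_1+k_0/\ell_2$ between $\ell_1$ and $\ell_2$ is derived in the paper from these constraints on $A$. Solutions with columns of $A$ linearly dependent over $\mathbb{R}$ are called reducible and discarded.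
   Formalization: The rotation factor R is assumed smooth on I, not only the product A = RB; otherwise R could jump by diag(−1,−1,1), absorbed by sign changes of b12, b25, b23, with A unchanged, and "R is constant" would fail. *)

theory Defs
  imports "HOL-Analysis.Analysis"
begin

(* C-infinity on S; intended for open S, where the two-sided iterated derivatives
   at points of S depend only on the restriction of f to S. *)
definition smooth_real_on :: "real set \<Rightarrow> (real \<Rightarrow> real) \<Rightarrow> bool" where
  "smooth_real_on S f \<longleftrightarrow> (\<forall>n. \<forall>t\<in>S. ((deriv ^^ n) f) differentiable (at t))"

definition smooth_matrix_on :: "real set \<Rightarrow> (real \<Rightarrow> real ^ 'n ^ 'm) \<Rightarrow> bool" where
  "smooth_matrix_on S M \<longleftrightarrow> (\<forall>i j. smooth_real_on S (\<lambda>t. M t $ i $ j))"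

definition Q :: "(real \<Rightarrow> real ^ 'n ^ 'm) \<Rightarrow> 'n \<Rightarrow> 'n \<Rightarrow> real \<Rightarrow> real" where
  "Q A i j t =
     vector_derivative (\<lambda>s. column i (A s)) (at t) \<bullet> column j (A t)
     - vector_derivative (\<lambda>s. column j (A s)) (at t) \<bullet> column i (A t)"

definition columns_independent_on :: "real set \<Rightarrow> (real \<Rightarrow> real ^ 'n ^ 'm) \<Rightarrow> bool" where
  "columns_independent_on S A \<longleftrightarrow>
     (\<forall>a :: 'n \<Rightarrow> real.
        (\<forall>t\<in>S. (\<Sum>j\<in>UNIV. a j *\<^sub>R column j (A t)) = 0) \<longrightarrow> (\<forall>j. a j = 0))"

definition SO3 :: "(real ^ 3 ^ 3) set" where
  "SO3 = {R. orthogonal_matrix R \<and> det R = 1}"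

(* In the index type 6 the numeral 6 equals 0, so the columns 1, ..., 6 are
   the six elements of the type; "vector" fills them in that order. *)
definition Bmat ::
  "real \<Rightarrow> real \<Rightarrow> real \<Rightarrow> real \<Rightarrow> real \<Rightarrow> real \<Rightarrow> real \<Rightarrow> real ^ 6 ^ 3" where
  "Bmat l1 l2 b12 b13 b15 b23 b25 = vector
     [vector [l1 * b12, b12, b13, l2 * b15, b15, l1 * b15 + b13 / l2],
      vector [0, 0, b23, l2 * b25, b25, l1 * b25 + b23 / l2],
      vector [0, 0, - 1 / (b12 * b25), 0, 0, - 1 / (l2 * b12 * b25)]]"

end

theory Submission
  imports Defs
begin

text \<open>
  Write \<open>p = l1\<close>, \<open>q = l2\<close> and let \<open>u, v, w\<close> be the columns 2, 5, 3 of \<open>A\<close>, so that the other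
  columns are \<open>p u\<close>, \<open>q v\<close> and \<open>w / q + p v\<close>. The quantity \<open>Q\<close> is a skew bracket
  \<open>[x, y] = x' \<bullet> y - y' \<bullet> x\<close> of curves (\<open>wronskian\<close>), and
  \<open>[f x, y] = f' (x \<bullet> y) + f [x, y]\<close>. Hence each hypothesis on \<open>Q\<close> is an equation between
  \<open>p\<close>, \<open>q\<close>, their derivatives, the Gram matrix of \<open>u, v, w\<close> and the brackets of
  \<open>u, v, w\<close> (\<open>parabolic_wronskians\<close>), the latter being constants. Since
  \<open>p' = (k2 - k0 / q\<^sup>2) q'\<close>, the derivatives enter the equations only through the products of
  \<open>q'\<close> with the Gram matrix. Eliminating these products leaves polynomial equations in
  \<open>q\<close> with constant coefficients.

  These are strong because \<open>q\<close> is not constant: otherwise \<open>p\<close> would be constant too and the first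
  column a constant multiple of the second. A nonconstant continuous function on an interval takes
  infinitely many values, so all coefficients vanish (\<open>cubic_coefficients_zero\<close>). In this way one
  finds \<open>u\<close> orthogonal to \<open>v\<close> and \<open>w\<close>, that is \<open>b15 = b13 = 0\<close>, and \<open>[u, v] = [u, w] = 0\<close>
  (\<open>second_column_orthogonal\<close>); then the form of \<open>w \<bullet> v\<close>, that is of \<open>b23\<close>
  (\<open>inner_third_fifth_column\<close>). What is left of the equations is an algebraic system at each
  time for \<open>q'\<close>, \<open>b12\<close> and \<open>b25\<close> (\<open>reduced_system_solution\<close>).

  Now \<open>u\<close> and \<open>v\<close> are multiples of the first two columns of \<open>R\<close>, and \<open>w\<close> is a combination of \<open>v\<close>
  and the third one. The known values of \<open>[u, v]\<close>, \<open>[u, w]\<close> and \<open>[w, v]\<close> therefore say that the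
  three brackets of the columns of \<open>R\<close> vanish. For an orthonormal frame these brackets are twice the
  entries of the angular velocity, so \<open>R\<close> is constant
  (\<open>orthogonal_path_constant_if_wronskians_zero\<close>).
\<close>

section \<open>Columns of the parabolic matrix\<close>

lemma vector_6:
  "(vector [a, b, c, d, e, f] :: 'a::zero ^ 6) $ 1 = a"
  "(vector [a, b, c, d, e, f] :: 'a::zero ^ 6) $ 2 = b"
  "(vector [a, b, c, d, e, f] :: 'a::zero ^ 6) $ 3 = c"
  "(vector [a, b, c, d, e, f] :: 'a::zero ^ 6) $ 4 = d"
  "(vector [a, b, c, d, e, f] :: 'a::zero ^ 6) $ 5 = e"
  "(vector [a, b, c, d, e, f] :: 'a::zero ^ 6) $ 6 = f"
  by (simp_all add: vector_def)

lemma column_matrix_mult_3: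
  fixes M :: "real ^ 3 ^ 'm" and N :: "real ^ 'n ^ 3"
  shows "column j (M ** N) =
    N $ 1 $ j *\<^sub>R column 1 M + N $ 2 $ j *\<^sub>R column 2 M + N $ 3 $ j *\<^sub>R column 3 M"
  by (simp add: vec_eq_iff column_def matrix_matrix_mult_def sum_3 mult.commute)

lemma columns_Bmat:
  fixes R :: "real ^ 3 ^ 3"
  defines "r \<equiv> \<lambda>i. column i R"
  assumes A: "A = R ** Bmat l1 l2 b12 b13 b15 b23 b25"
  shows "column 2 A = b12 *\<^sub>R r 1"
    and "column 5 A = b15 *\<^sub>R r 1 + b25 *\<^sub>R r 2"
    and "column 3 A = b13 *\<^sub>R r 1 + b23 *\<^sub>R r 2 + (- 1 / (b12 * b25)) *\<^sub>R r 3"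
    and "column 1 A = l1 *\<^sub>R column 2 A"
    and "column 4 A = l2 *\<^sub>R column 5 A"
    and "column 6 A = (1 / l2) *\<^sub>R column 3 A + l1 *\<^sub>R column 5 A"
  unfolding A column_matrix_mult_3 r_def
  by (simp_all add: Bmat_def vector_6 algebra_simps)

lemma independent_columns_not_proportional:
  assumes indep: "columns_independent_on S A" and "i \<noteq> j"
    and multiple: "\<And>t. t \<in> S \<Longrightarrow> column i (A t) = a *\<^sub>R column j (A t)"
  shows False
proof -
  define e where "e k = (if k = i then 1 else if k = j then - a else 0)" for k
  have "(\<Sum>k\<in>UNIV. e k *\<^sub>R column k (A t)) = 0" if "t \<in> S" for t
  proof -
    have "e k *\<^sub>R column k (A t)
        = (if k = i then column i (A t) else 0) + (if k = j then - a *\<^sub>R column j (A t) else 0)" for k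
      using \<open>i \<noteq> j\<close> by (auto simp: e_def)
    then show ?thesis
      by (simp add: sum.distrib multiple[OF that])
  qed
  then have "e i = 0"
    using indep unfolding columns_independent_on_def by blast
  then show False
    by (simp add: e_def)
qed

lemma smooth_matrix_on_column_differentiable:
  fixes M :: "real \<Rightarrow> real ^ 'n ^ 'm"
  assumes "smooth_matrix_on S M" "t \<in> S"
  shows "(\<lambda>s. column j (M s)) differentiable at t"
proof -
  have "(\<lambda>s. M s $ i $ j) differentiable at t" for i
    using assms unfolding smooth_matrix_on_def smooth_real_on_def by (metis funpow_0)
  then show ?thesis
    by (subst differentiable_componentwise_within)
       (auto simp: Basis_vec_def inner_axis column_def)
qed

lemma differentiable_cong_open:
  assumes "f differentiable at t" "open S" "t \<in> S" "\<And>s. s \<in> S \<Longrightarrow> f s = g s"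
  shows "g differentiable at t"
  using assms unfolding differentiable_def
  by (metis has_derivative_transform_within_open)

section \<open>The skew bracket of two curves\<close>

definition wronskian :: "(real \<Rightarrow> 'a::real_inner) \<Rightarrow> (real \<Rightarrow> 'a) \<Rightarrow> real \<Rightarrow> real" where
  "wronskian x y t =
     vector_derivative x (at t) \<bullet> y t - vector_derivative y (at t) \<bullet> x t"

lemma Q_eq_wronskian: "Q A i j = wronskian (\<lambda>s. column i (A s)) (\<lambda>s. column j (A s))"
  by (simp add: fun_eq_iff Q_def wronskian_def)

lemma wronskian_self [simp]: "wronskian x x t = 0"
  by (simp add: wronskian_def)

lemma wronskian_swap: "wronskian y x t = - wronskian x y t"
  by (simp add: wronskian_def)

lemma wronskian_cong:
  assumes "open S" "t \<in> S" "\<And>s. s \<in> S \<Longrightarrow> x s = x' s" "\<And>s. s \<in> S \<Longrightarrow> y s = y' s"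
  shows "wronskian x y t = wronskian x' y' t"
proof -
  have ev: "\<forall>\<^sub>F s in nhds t. s \<in> S"
    using assms(1,2) by (rule eventually_nhds_in_open)
  have "vector_derivative x (at t) = vector_derivative x' (at t)"
       "vector_derivative y (at t) = vector_derivative y' (at t)"
    using ev assms(3,4) by (auto intro!: vector_derivative_cong_eq elim!: eventually_mono)
  then show ?thesis
    using assms by (simp add: wronskian_def)
qed

lemma wronskian_scaleR_left:
  assumes "f differentiable at t" "x differentiable at t"
  shows "wronskian (\<lambda>s. f s *\<^sub>R x s) y t = deriv f t * (x t \<bullet> y t) + f t * wronskian x y t"
proof -
  have "(f has_real_derivative deriv f t) (at t)"
    using assms(1) by (simp add: DERIV_deriv_iff_real_differentiable)
  moreover have "(x has_vector_derivative vector_derivative x (at t)) (at t)"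
    using assms(2) by (simp add: vector_derivative_works)
  ultimately have "((\<lambda>s. f s *\<^sub>R x s) has_vector_derivative
      f t *\<^sub>R vector_derivative x (at t) + deriv f t *\<^sub>R x t) (at t)"
    by (rule has_vector_derivative_scaleR)
  then have "vector_derivative (\<lambda>s. f s *\<^sub>R x s) (at t) =
      f t *\<^sub>R vector_derivative x (at t) + deriv f t *\<^sub>R x t"
    by (rule vector_derivative_at)
  then show ?thesis
    by (simp add: wronskian_def inner_add_left algebra_simps)
qed

lemma wronskian_add_left:
  assumes "x differentiable at t" "y differentiable at t"
  shows "wronskian (\<lambda>s. x s + y s) z t = wronskian x z t + wronskian y z t"
  using assms by (simp add: wronskian_def inner_add_left inner_add_right)

lemma wronskian_scaleR_right:
  assumes "f differentiable at t" "y differentiable at t"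
  shows "wronskian x (\<lambda>s. f s *\<^sub>R y s) t = - deriv f t * (x t \<bullet> y t) + f t * wronskian x y t"
  using wronskian_scaleR_left[OF assms, of x] wronskian_swap[of _ x t]
  by (simp add: inner_commute)

lemma wronskian_add_right:
  assumes "x differentiable at t" "y differentiable at t"
  shows "wronskian z (\<lambda>s. x s + y s) t = wronskian z x t + wronskian z y t"
  using assms by (simp add: wronskian_def inner_add_left inner_add_right)

lemma wronskian_scaled_orthogonal:
  assumes "f differentiable at t" "g differentiable at t" "x differentiable at t" "y differentiable at t"
    and "x t \<bullet> y t = 0"
  shows "wronskian (\<lambda>s. f s *\<^sub>R x s) (\<lambda>s. g s *\<^sub>R y s) t = f t * g t * wronskian x y t"
  using assms by (simp add: wronskian_scaleR_left wronskian_scaleR_right)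

text \<open>Differentiating the orthonormality relations makes \<open>x' \<bullet> y\<close> skew in the columns \<open>x, y\<close>
  of \<open>R\<close>, and vanishing brackets make it symmetric. So the derivative of each column is orthogonal
  to all columns, which span the space.\<close>
lemma orthogonal_path_constant_if_wronskians_zero:
  fixes R :: "real \<Rightarrow> real ^ 'n ^ 'n"
  assumes I: "open I" "connected I"
    and diff: "\<And>i t. t \<in> I \<Longrightarrow> (\<lambda>s. column i (R s)) differentiable at t"
    and orth: "\<And>t. t \<in> I \<Longrightarrow> orthogonal_matrix (R t)"
    and zero: "\<And>i j t. t \<in> I \<Longrightarrow>
      wronskian (\<lambda>s. column i (R s)) (\<lambda>s. column j (R s)) t = 0"
  shows "R constant_on I"
proof -
  define r where "r i s = column i (R s)" for i s
  define r' where "r' i t = vector_derivative (r i) (at t)" for i t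
  have der: "(r i has_vector_derivative r' i t) (at t)" if "t \<in> I" for i t
    using diff[OF that, of i] by (simp add: r_def[abs_def] r'_def vector_derivative_works)
  have "r' i t \<bullet> r j t = 0" if t: "t \<in> I" for i j t
  proof -
    have const: "r i s \<bullet> r j s = (if i = j then 1 else 0)" if "s \<in> I" for s
      using orth[OF that]
      by (auto simp: orthogonal_matrix_orthonormal_columns orthogonal_def r_def norm_eq_1)
    have "((\<lambda>s. r i s \<bullet> r j s) has_vector_derivative r i t \<bullet> r' j t + r' i t \<bullet> r j t) (at t)"
      by (rule bounded_bilinear.has_vector_derivative[OF bounded_bilinear_inner der[OF t] der[OF t]])
    moreover have "((\<lambda>s. r i s \<bullet> r j s) has_vector_derivative 0) (at t)"
      by (rule has_vector_derivative_transform_within_open[OF has_vector_derivative_const I(1) t])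
         (simp add: const)
    ultimately have "r i t \<bullet> r' j t + r' i t \<bullet> r j t = 0"
      by (rule vector_derivative_unique_at)
    moreover have "r' i t \<bullet> r j t - r' j t \<bullet> r i t = 0"
      using zero[OF t, of i j] by (simp add: wronskian_def r'_def r_def[abs_def])
    ultimately show ?thesis
      by (simp add: inner_commute)
  qed
  then have perp: "transpose (R t) *v r' i t = 0" if "t \<in> I" for i t
    using that by (simp add: vec_eq_iff matrix_vector_mult_def transpose_def r_def inner_vec_def
      column_def mult.commute)
  have r'0: "r' i t = 0" if "t \<in> I" for i t
  proof -
    have "r' i t = (R t ** transpose (R t)) *v r' i t"
      using orth[OF that] by (simp add: orthogonal_matrix_def)
    also have "\<dots> = R t *v (transpose (R t) *v r' i t)"
      by (simp add: matrix_vector_mul_assoc del: transpose_matrix_vector)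
    finally show ?thesis
      using perp[OF that] by simp
  qed
  have "\<exists>b. \<forall>t\<in>I. R t $ k $ i = b" for k i
  proof -
    have "((\<lambda>s. r i s $ k) has_vector_derivative 0) (at t)" if "t \<in> I" for t
      using bounded_linear.has_vector_derivative[OF bounded_linear_vec_nth der[OF that, of i], of k]
      by (simp add: r'0[OF that])
    then have d: "DERIV (\<lambda>s. R s $ k $ i) t :> 0" if "t \<in> I" for t
      using that by (simp add: has_real_derivative_iff_has_vector_derivative r_def column_def)
    have "(\<lambda>s. R s $ k $ i) constant_on I"
      by (rule DERIV_zero_connected_constant_on[OF I(2,1) finite.emptyI])
         (use d in \<open>auto intro!: continuous_at_imp_continuous_on DERIV_isCont\<close>)
    then show ?thesis
      by (simp add: constant_on_def)
  qed
  then obtain b where "\<And>k i t. t \<in> I \<Longrightarrow> R t $ k $ i = b k i"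
    by metis
  then have "\<forall>t\<in>I. R t = (\<chi> k i. b k i)"
    by (simp add: vec_eq_iff)
  then show ?thesis
    by (auto simp: constant_on_def)
qed

lemma wronskian_sixth_column:
  assumes diff: "p differentiable at t" "q differentiable at t"
      "v differentiable at t" "w differentiable at t"
    and q: "q t \<noteq> 0"
  shows "wronskian x (\<lambda>s. (1 / q s) *\<^sub>R w s + p s *\<^sub>R v s) t
    = deriv q t / (q t)\<^sup>2 * (x t \<bullet> w t) + wronskian x w t / q t
      - deriv p t * (x t \<bullet> v t) + p t * wronskian x v t"
proof -
  have "(q has_real_derivative deriv q t) (at t)"
    using diff(2) by (simp add: DERIV_deriv_iff_real_differentiable)
  then have "((\<lambda>s. 1 / q s) has_real_derivative - deriv q t / (q t)\<^sup>2) (at t)"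
    using q by (auto intro!: derivative_eq_intros simp: power2_eq_square)
  then have dinv: "deriv (\<lambda>s. 1 / q s) t = - deriv q t / (q t)\<^sup>2"
    and inv: "(\<lambda>s. 1 / q s) differentiable at t"
    by (auto simp: DERIV_imp_deriv real_differentiable_def)
  have "(\<lambda>s. (1 / q s) *\<^sub>R w s) differentiable at t" "(\<lambda>s. p s *\<^sub>R v s) differentiable at t"
    using diff inv by (auto intro: differentiable_scaleR)
  then show ?thesis
    by (simp add: wronskian_add_right wronskian_scaleR_right[OF inv diff(4)]
        wronskian_scaleR_right[OF diff(1,3)] dinv)
qed

text \<open>The bracket fails to be bilinear over functions only by terms with a factor \<open>p'\<close> or \<open>q'\<close>.
  So the brackets of the columns \<open>p u, u, w, q v, v, w / q + p v\<close> reduce to those of \<open>u, v, w\<close>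
  and to products of \<open>p'\<close> and \<open>q'\<close> with the Gram matrix.\<close>
lemma parabolic_wronskians:
  assumes diff: "p differentiable at t" "q differentiable at t"
      "u differentiable at t" "v differentiable at t" "w differentiable at t"
    and q: "q t \<noteq> 0"
  shows "wronskian (\<lambda>s. p s *\<^sub>R u s) u t = deriv p t * (u t \<bullet> u t)"
    and "wronskian (\<lambda>s. p s *\<^sub>R u s) w t = deriv p t * (u t \<bullet> w t) + p t * wronskian u w t"
    and "wronskian (\<lambda>s. p s *\<^sub>R u s) (\<lambda>s. q s *\<^sub>R v s) t
      = deriv p t * (q t * (u t \<bullet> v t)) + p t * wronskian u (\<lambda>s. q s *\<^sub>R v s) t"
    and "wronskian u (\<lambda>s. q s *\<^sub>R v s) t = q t * wronskian u v t - deriv q t * (u t \<bullet> v t)"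
    and "wronskian (\<lambda>s. p s *\<^sub>R u s) v t
      - wronskian u (\<lambda>s. (1 / q s) *\<^sub>R w s + p s *\<^sub>R v s) t
      = 2 * deriv p t * (u t \<bullet> v t) - wronskian u w t / q t - deriv q t / (q t)\<^sup>2 * (u t \<bullet> w t)"
    and "wronskian w (\<lambda>s. (1 / q s) *\<^sub>R w s + p s *\<^sub>R v s) t
      = deriv q t / (q t)\<^sup>2 * (w t \<bullet> w t) + p t * wronskian w v t - deriv p t * (w t \<bullet> v t)"
    and "wronskian (\<lambda>s. q s *\<^sub>R v s) v t = deriv q t * (v t \<bullet> v t)"
    and "wronskian (\<lambda>s. q s *\<^sub>R v s) (\<lambda>s. (1 / q s) *\<^sub>R w s + p s *\<^sub>R v s) t
      = 2 * deriv q t / q t * (w t \<bullet> v t)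
        + (deriv q t * p t - q t * deriv p t) * (v t \<bullet> v t) - wronskian w v t"
    and "wronskian v (\<lambda>s. (1 / q s) *\<^sub>R w s + p s *\<^sub>R v s) t
      = - wronskian w v t / q t + deriv q t / (q t)\<^sup>2 * (w t \<bullet> v t) - deriv p t * (v t \<bullet> v t)"
  using q
  by (simp add: wronskian_sixth_column[OF diff(1,2,4,5) q]
      wronskian_scaleR_left[OF diff(1,3)] wronskian_scaleR_left[OF diff(2,4)]
      wronskian_scaleR_right[OF diff(2,4)] wronskian_swap[of v w] inner_commute[of "v t" "w t"];
    simp add: field_simps power2_eq_square)+

section \<open>Constancy of the brackets as polynomial identities\<close>

lemma cubic_coefficients_zero:
  fixes a b c d :: real
  assumes "infinite S" and "\<And>x. x \<in> S \<Longrightarrow> a + b * x + c * x\<^sup>2 + d * x ^ 3 = 0"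
  shows "a = 0" "b = 0" "c = 0" "d = 0"
proof -
  have "S \<subseteq> {x. poly [:a, b, c, d:] x = 0}"
    using assms(2) by (auto simp: algebra_simps power2_eq_square power3_eq_cube)
  then have "[:a, b, c, d:] = 0"
    using assms(1) poly_roots_finite finite_subset by blast
  then show "a = 0" "b = 0" "c = 0" "d = 0"
    by simp_all
qed

lemma infinite_image_if_nonconstant:
  fixes q :: "real \<Rightarrow> real"
  assumes "connected I" "continuous_on I q" "\<not> q constant_on I"
  shows "infinite (q ` I)"
proof
  assume "finite (q ` I)"
  then obtain a where "q ` I \<subseteq> {a}"
    using connected_continuous_image[OF assms(2,1)] connected_finite_iff_sing by fastforce
  then have "q constant_on I"
    unfolding constant_on_def by blast
  then show False
    using assms(3) by simp
qed

text \<open>The equation for the bracket of the columns 2 and 4 expresses \<open>q' F\<close> by \<open>q\<close>; inserted into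
  the one for 1 and 4, it gives a cubic equation for \<open>q\<close> and hence \<open>F = 0\<close>. Then the equation for
  the difference of the brackets 15 and 26 expresses \<open>q' H\<close> by \<open>q\<close>, and the bracket 13 gives
  another cubic equation. The intended functions are \<open>F = u \<bullet> v\<close> and \<open>H = u \<bullet> w\<close>. In this and the
  following lemmas \<open>q'\<close> stands for the derivative of \<open>q\<close>, so that \<open>k2 q' - k0 q' / q\<^sup>2\<close> is the
  derivative of \<open>p = k2 q + k1 + k0 / q\<close>.\<close>
lemma second_column_orthogonal:
  fixes q q' F H :: "real \<Rightarrow> real"
  assumes inf: "infinite (q ` I)" and k: "k0 \<noteq> 0" "k2 \<noteq> 0"
    and q: "\<And>t. t \<in> I \<Longrightarrow> q t \<noteq> 0" and q': "\<And>t. t \<in> I \<Longrightarrow> q' t \<noteq> 0"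
    and Q24: "\<And>t. t \<in> I \<Longrightarrow> q t * c25 - q' t * F t = c24"
    and Q14: "\<And>t. t \<in> I \<Longrightarrow>
      (k2 * q' t - k0 * q' t / (q t)\<^sup>2) * (q t * F t) + (k2 * q t + k1 + k0 / q t) * c24 = c14"
    and Q13: "\<And>t. t \<in> I \<Longrightarrow>
      (k2 * q' t - k0 * q' t / (q t)\<^sup>2) * H t + (k2 * q t + k1 + k0 / q t) * c23 = c13"
    and Q15_26: "\<And>t. t \<in> I \<Longrightarrow>
      2 * (k2 * q' t - k0 * q' t / (q t)\<^sup>2) * F t - c23 / q t - q' t / (q t)\<^sup>2 * H t = d"
  shows "c25 = 0" "c23 = 0" "\<And>t. t \<in> I \<Longrightarrow> F t = 0" "\<And>t. t \<in> I \<Longrightarrow> H t = 0"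
proof -
  have "2 * k0 * c24 + (k1 * c24 - k0 * c25 - c14) * x + 0 * x\<^sup>2 + (k2 * c25) * x ^ 3 = 0"
    if "x \<in> q ` I" for x
  proof -
    from that obtain t where t: "t \<in> I" and x: "x = q t" by auto
    have F: "q' t * F t = x * c25 - c24" using Q24[OF t] x by simp
    have "(k2 * q' t - k0 * q' t / (q t)\<^sup>2) * (q t * F t) = (k2 - k0 / x\<^sup>2) * x * (q' t * F t)"
      by (simp add: x algebra_simps)
    note eq = Q14[OF t, unfolded this[unfolded F], folded x]
    have "2 * k0 * c24 + (k1 * c24 - k0 * c25 - c14) * x + 0 * x\<^sup>2 + (k2 * c25) * x ^ 3
      = x * ((k2 - k0 / x\<^sup>2) * x * (x * c25 - c24) + (k2 * x + k1 + k0 / x) * c24 - c14)"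
      using q[OF t] by (simp add: x field_simps power2_eq_square power3_eq_cube)
    with eq show ?thesis by simp
  qed
  note co = cubic_coefficients_zero[OF inf this]
  show c25: "c25 = 0" using co(4) k by simp
  have c24: "c24 = 0" using co(1) k by simp
  show F: "F t = 0" if "t \<in> I" for t
    using Q24[OF that] q'[OF that] c24 c25 by simp
  have H: "q' t * H t = - d * (q t)\<^sup>2 - c23 * q t" if "t \<in> I" for t
    using Q15_26[OF that] q[OF that] by (simp add: F[OF that] field_simps power2_eq_square)
  have "(2 * k0 * c23) + (k0 * d + k1 * c23 - c13) * x + 0 * x\<^sup>2 + (- d * k2) * x ^ 3 = 0"
    if "x \<in> q ` I" for x
  proof -
    from that obtain t where t: "t \<in> I" and x: "x = q t" by auto
    have "(k2 * q' t - k0 * q' t / (q t)\<^sup>2) * H t = (k2 - k0 / x\<^sup>2) * (q' t * H t)"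
      by (simp add: x algebra_simps)
    note eq = Q13[OF t, unfolded this[unfolded H[OF t]], folded x]
    have "(2 * k0 * c23) + (k0 * d + k1 * c23 - c13) * x + 0 * x\<^sup>2 + (- d * k2) * x ^ 3
      = x * ((k2 - k0 / x\<^sup>2) * (- d * x\<^sup>2 - c23 * x) + (k2 * x + k1 + k0 / x) * c23 - c13)"
      using q[OF t] by (simp add: x field_simps power2_eq_square power3_eq_cube)
    with eq show ?thesis by simp
  qed
  note co = cubic_coefficients_zero[OF inf this]
  show c23: "c23 = 0" using co(1) k by simp
  have d: "d = 0" using co(4) k by simp
  show "H t = 0" if "t \<in> I" for t
    using H[OF that] q'[OF that] c23 d by simp
qed

text \<open>With \<open>G = v \<bullet> v\<close> and \<open>K = w \<bullet> v\<close>, the bracket 56 makes \<open>q' K\<close> a quadratic polynomial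
  in \<open>q\<close>. The bracket 46 forces its quadratic coefficient to vanish, and the quotient of
  \<open>q' K\<close> by \<open>q' G = c45\<close> is the claim.\<close>
lemma inner_third_fifth_column:
  fixes q q' G K :: "real \<Rightarrow> real"
  assumes inf: "infinite (q ` I)"
    and q: "\<And>t. t \<in> I \<Longrightarrow> q t \<noteq> 0" and c45: "c45 \<noteq> 0"
    and Q45: "\<And>t. t \<in> I \<Longrightarrow> q' t * G t = c45"
    and Q46: "\<And>t. t \<in> I \<Longrightarrow> 2 * q' t / q t * K t
       + (q' t * (k2 * q t + k1 + k0 / q t) - q t * (k2 * q' t - k0 * q' t / (q t)\<^sup>2)) * G t - c35 = c46"
    and Q56: "\<And>t. t \<in> I \<Longrightarrow>
       - c35 / q t + q' t / (q t)\<^sup>2 * K t - (k2 * q' t - k0 * q' t / (q t)\<^sup>2) * G t = c56"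
    and t: "t \<in> I"
  shows "K t = (c35 / c45 * q t - k0) * G t"
proof -
  have K: "q' t * K t = (c56 + c45 * k2) * (q t)\<^sup>2 + c35 * q t - c45 * k0" if t: "t \<in> I" for t
  proof -
    have "(k2 * q' t - k0 * q' t / (q t)\<^sup>2) * G t = (k2 - k0 / (q t)\<^sup>2) * (q' t * G t)"
      by (simp add: algebra_simps)
    note eq = Q56[OF t, unfolded this[unfolded Q45[OF t]]]
    have "q' t * K t = (q t)\<^sup>2 * (- c35 / q t + q' t / (q t)\<^sup>2 * K t - (k2 - k0 / (q t)\<^sup>2) * c45)
       + c45 * k2 * (q t)\<^sup>2 + c35 * q t - c45 * k0"
      using q[OF t] by (simp add: field_simps power2_eq_square)
    then show ?thesis
      unfolding eq by (simp add: algebra_simps)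
  qed
  have "(c35 + c45 * k1 - c46) + 2 * (c56 + c45 * k2) * x + 0 * x\<^sup>2 + 0 * x ^ 3 = 0"
    if "x \<in> q ` I" for x
  proof -
    from that obtain t where t: "t \<in> I" and x: "x = q t" by auto
    have "(q' t * (k2 * q t + k1 + k0 / q t) - q t * (k2 * q' t - k0 * q' t / (q t)\<^sup>2)) * G t
       = (k1 + 2 * k0 / x) * (q' t * G t)"
      using q[OF t] by (simp add: x field_simps power2_eq_square)
    note G = this[unfolded Q45[OF t]]
    have "2 * q' t / q t * K t = 2 / x * (q' t * K t)"
      by (simp add: x)
    note KK = this[unfolded K[OF t]]
    note eq = Q46[OF t, unfolded G KK, folded x]
    have "(c35 + c45 * k1 - c46) + 2 * (c56 + c45 * k2) * x + 0 * x\<^sup>2 + 0 * x ^ 3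
      = 2 / x * ((c56 + c45 * k2) * x\<^sup>2 + c35 * x - c45 * k0) + (k1 + 2 * k0 / x) * c45 - c35 - c46"
      using q[OF t] by (simp add: x field_simps power2_eq_square)
    with eq show ?thesis by simp
  qed
  note co = cubic_coefficients_zero[OF inf this]
  have "q' t * K t = c35 * q t - c45 * k0"
    using K[OF t] co(2) by simp
  moreover have "q' t \<noteq> 0" using Q45[OF t] c45 by auto
  moreover have "q' t * ((c35 / c45 * q t - k0) * G t) = (c35 / c45 * q t - k0) * (q' t * G t)"
    by simp
  then have "q' t * ((c35 / c45 * q t - k0) * G t) = c35 * q t - c45 * k0"
    unfolding Q45[OF t] using c45 by (simp add: algebra_simps)
  ultimately show ?thesis by (metis mult_left_cancel)
qed

text \<open>The system arises when \<open>w\<close> has the components \<open>(k4 q - k0) b25\<close> and \<open>- 1 / (b12 b25)\<close>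
  along the last two columns of \<open>R\<close>. In the equation for the bracket 36 all powers of \<open>q\<close> coming
  from the first component cancel, up to the constant \<open>c45 (k4\<^sup>2 + k1 k4 + k0 k2)\<close>, so
  the contribution \<open>q' / (q\<^sup>2 b12\<^sup>2 b25\<^sup>2)\<close> of the second is constant as well. Eliminating
  \<open>b12\<close> and \<open>b25\<close> by means of the brackets 12 and 45 turns this constant into
  \<open>- k3 / (c12 c45)\<close> and the equation into the one for \<open>q' ^ 3\<close>.\<close>
lemma reduced_system_solution:
  fixes b12 b25 :: real
  defines "E \<equiv> b12\<^sup>2" and "G \<equiv> b25\<^sup>2"
  assumes nz: "b12 \<noteq> 0" "b25 \<noteq> 0" "q \<noteq> 0" "c12 \<noteq> 0" "c45 \<noteq> 0"
    and Q12: "(k2 * q' - k0 * q' / q\<^sup>2) * E = c12"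
    and Q45: "q' * G = c45"
    and Q36: "q' / q\<^sup>2 * ((k4 * q - k0)\<^sup>2 * G + 1 / (E * G)) + (k2 * q + k1 + k0 / q) * (k4 * c45)
       - (k2 * q' - k0 * q' / q\<^sup>2) * ((k4 * q - k0) * G) = c36"
    and k3: "k3 = - c12 * c45 * (c36 - c45 * (k4\<^sup>2 + k1 * k4 + k0 * k2))"
  shows "k3 \<noteq> 0" "k0 - k2 * q\<^sup>2 \<noteq> 0"
    "q' ^ 3 = k3 * q ^ 4 / (k0 - k2 * q\<^sup>2)"
    "b25 ^ 6 = c45 ^ 3 * (k0 - k2 * q\<^sup>2) / (k3 * q ^ 4)"
    "b12\<^sup>2 = - (c12 * b25\<^sup>2 * q\<^sup>2) / (c45 * (k0 - k2 * q\<^sup>2))"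
proof -
  have q': "q' \<noteq> 0" using Q45 nz by auto
  have G: "G = c45 / q'" using Q45 q' by (simp add: field_simps)
  define D where "D = k0 - k2 * q\<^sup>2"
  have "- q' * D * E = c12 * q\<^sup>2"
    using Q12 nz by (simp add: D_def field_simps power2_eq_square)
  then have D: "D \<noteq> 0" using nz by auto
  have E: "E = - c12 * q\<^sup>2 / (q' * D)"
    using \<open>- q' * D * E = c12 * q\<^sup>2\<close> D q' by (simp add: field_simps)
  have "q' / q\<^sup>2 * ((k4 * q - k0)\<^sup>2 * G) + (k2 * q + k1 + k0 / q) * (k4 * c45)
       - (k2 * q' - k0 * q' / q\<^sup>2) * ((k4 * q - k0) * G) = c45 * (k4\<^sup>2 + k1 * k4 + k0 * k2)"
    unfolding G using nz q' by (simp add: field_simps power2_eq_square)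
  with Q36 have "q' / q\<^sup>2 * (1 / (E * G)) = c36 - c45 * (k4\<^sup>2 + k1 * k4 + k0 * k2)"
    by (simp add: distrib_left)
  then have "k3 = - c12 * c45 * (q' / q\<^sup>2 * (1 / (E * G)))"
    using k3 by simp
  also have "\<dots> = q' ^ 3 * D / q ^ 4"
    unfolding E G using nz q' D by (simp add: field_simps power2_eq_square power3_eq_cube power4_eq_xxxx)
  finally have k3': "k3 = q' ^ 3 * D / q ^ 4" .
  then show "k3 \<noteq> 0" using nz q' D by simp
  show "k0 - k2 * q\<^sup>2 \<noteq> 0" using D by (simp add: D_def)
  show "q' ^ 3 = k3 * q ^ 4 / (k0 - k2 * q\<^sup>2)"
    using k3' D nz unfolding D_def[symmetric] by simp
  have "b25 ^ 6 = G ^ 3" by (simp add: G_def flip: power_mult)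
  also have "\<dots> = c45 ^ 3 * D / (k3 * q ^ 4)"
    unfolding G k3' using nz q' D by (simp add: power_divide)
  finally show "b25 ^ 6 = c45 ^ 3 * (k0 - k2 * q\<^sup>2) / (k3 * q ^ 4)"
    by (simp add: D_def)
  have "E = - (c12 * G * q\<^sup>2) / (c45 * D)"
    unfolding E G using nz q' D by (simp add: field_simps)
  then show "b12\<^sup>2 = - (c12 * b25\<^sup>2 * q\<^sup>2) / (c45 * (k0 - k2 * q\<^sup>2))"
    by (simp add: E_def G_def D_def)
qed

section \<open>Rigidity of the frame and the remaining equations\<close>

theorem lemma8p1:
  fixes I :: "real set"
    and A :: "real \<Rightarrow> real ^ 6 ^ 3"
    and R :: "real \<Rightarrow> real ^ 3 ^ 3"
    and l1 l2 b12 b13 b15 b23 b25 :: "real \<Rightarrow> real"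
    and c :: "6 \<Rightarrow> 6 \<Rightarrow> real"
    and k0 k1 k2 :: real
  assumes I: "open I" "is_interval I"
    and A_smooth: "smooth_matrix_on I A"
    and R_smooth: "smooth_matrix_on I R"
    and R_SO3: "\<forall>t\<in>I. R t \<in> SO3"
    and A_eq: "\<forall>t\<in>I. A t =
      R t ** Bmat (l1 t) (l2 t) (b12 t) (b13 t) (b15 t) (b23 t) (b25 t)"
    and indep: "columns_independent_on I A"
    and nz: "\<forall>t\<in>I. b12 t \<noteq> 0 \<and> b25 t \<noteq> 0 \<and> l2 t \<noteq> 0"
    and Q_const: "\<forall>(i, j) \<in> {(1, 2), (1, 3), (1, 4), (2, 5), (2, 3), (2, 4),
        (3, 5), (3, 6), (4, 5), (4, 6), (5, 6)}. \<forall>t\<in>I. Q A i j t = c i j"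
    and Q_diff: "(\<lambda>t. Q A 1 5 t - Q A 2 6 t) constant_on I"
    and l1_eq: "\<forall>t\<in>I. l1 t = k2 * l2 t + k1 + k0 / l2 t"
    and k_nz: "k2 * k0 \<noteq> 0"
  shows "R constant_on I \<and>
    (\<exists>k3 k4 :: real.
       k3 \<noteq> 0 \<and> c 4 5 \<noteq> 0 \<and>
       (\<forall>t\<in>I.
          k0 - k2 * (l2 t)\<^sup>2 \<noteq> 0 \<and>
          (deriv l2 t) ^ 3 = k3 * (l2 t) ^ 4 / (k0 - k2 * (l2 t)\<^sup>2) \<and>
          l1 t = k2 * l2 t + k1 + k0 / l2 t \<and>
          (b25 t) ^ 6 = (c 4 5) ^ 3 * (k0 - k2 * (l2 t)\<^sup>2) / (k3 * (l2 t) ^ 4) \<and>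
          b13 t = 0 \<and> b15 t = 0 \<and>
          b23 t = (k4 * l2 t - k0) * b25 t \<and>
          (b12 t)\<^sup>2 = - (c 1 2 * (b25 t)\<^sup>2 * (l2 t)\<^sup>2)
                          / (c 4 5 * (k0 - k2 * (l2 t)\<^sup>2))))"
proof -
  define u v w where "u t = column 2 (A t)" and "v t = column 5 (A t)" and "w t = column 3 (A t)" for t
  define r where "r i t = column i (R t)" for i t
  define q' where "q' t = deriv l2 t" for t
  have k: "k0 \<noteq> 0" "k2 \<noteq> 0"
    using k_nz by auto
  have conn: "connected I"
    using I(2) by (rule is_interval_connected)
  have nz': "b12 t \<noteq> 0" "b25 t \<noteq> 0" "l2 t \<noteq> 0" if "t \<in> I" for t
    using nz that by auto
  note cols = columns_Bmat[OF A_eq[rule_format]]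
  have u: "u t = b12 t *\<^sub>R r 1 t"
    and v: "v t = b15 t *\<^sub>R r 1 t + b25 t *\<^sub>R r 2 t"
    and w: "w t = b13 t *\<^sub>R r 1 t + b23 t *\<^sub>R r 2 t + (- 1 / (b12 t * b25 t)) *\<^sub>R r 3 t"
    and A1: "column 1 (A t) = l1 t *\<^sub>R u t"
    and A4: "column 4 (A t) = l2 t *\<^sub>R v t"
    and A6: "column 6 (A t) = (1 / l2 t) *\<^sub>R w t + l1 t *\<^sub>R v t"
    if "t \<in> I" for t
    using cols[OF that] by (simp_all add: u_def v_def w_def r_def)
  have R_orth: "orthogonal_matrix (R t)" if "t \<in> I" for t
    using R_SO3 that by (simp add: SO3_def)
  have rr: "r i t \<bullet> r j t = (if i = j then 1 else 0)" if "t \<in> I" for i j t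
    using R_orth[OF that]
    by (auto simp: orthogonal_matrix_orthonormal_columns orthogonal_def r_def norm_eq_1)
  have r_diff: "r i differentiable at t" if "t \<in> I" for i t
    using smooth_matrix_on_column_differentiable[OF R_smooth that] by (simp add: r_def[abs_def])
  note A_diff = smooth_matrix_on_column_differentiable[OF A_smooth]
  have u_diff: "u differentiable at t" and v_diff: "v differentiable at t"
    and w_diff: "w differentiable at t" if "t \<in> I" for t
    using A_diff[OF that] by (simp_all add: u_def[abs_def] v_def[abs_def] w_def[abs_def])
  have vv_pos: "v t \<bullet> v t > 0" if "t \<in> I" for t
    using nz'[OF that] rr[OF that]
    by (simp add: v[OF that] inner_add_left inner_add_right sum_squares_gt_zero_iff)
  have uu_pos: "u t \<bullet> u t > 0" if "t \<in> I" for t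
    using nz'[OF that] rr[OF that] by (simp add: u[OF that] flip: power2_eq_square)
  \<comment> \<open>Only \<open>A\<close> and \<open>R\<close> are given as smooth: \<open>l2\<close> is recovered as the ratio of columns 4 and 5.\<close>
  have l2_diff: "l2 differentiable at t" if t: "t \<in> I" for t
  proof (rule differentiable_cong_open[OF _ I(1) t])
    show "(\<lambda>s. (column 4 (A s) \<bullet> v s) / (v s \<bullet> v s)) differentiable at t"
      using A_diff[OF t] v_diff[OF t] vv_pos[OF t]
      by (auto intro!: differentiable_divide differentiable_inner)
    show "(column 4 (A s) \<bullet> v s) / (v s \<bullet> v s) = l2 s" if "s \<in> I" for s
      using vv_pos[OF that] by (simp add: A4[OF that])
  qed
  have l2_DERIV: "(l2 has_real_derivative q' t) (at t)" if "t \<in> I" for t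
    using l2_diff[OF that] by (simp add: q'_def DERIV_deriv_iff_real_differentiable)
  have l1_DERIV: "(l1 has_real_derivative (k2 * q' t - k0 * q' t / (l2 t)\<^sup>2)) (at t)" if t: "t \<in> I" for t
  proof (rule has_field_derivative_transform_within_open[OF _ I(1) t])
    show "((\<lambda>s. k2 * l2 s + k1 + k0 / l2 s) has_real_derivative
        (k2 * q' t - k0 * q' t / (l2 t)\<^sup>2)) (at t)"
      using nz'[OF t] by (auto intro!: derivative_eq_intros l2_DERIV[OF t] simp: power2_eq_square)
  qed (simp add: l1_eq)
  have l1_diff: "l1 differentiable at t" and dl1: "deriv l1 t = k2 * q' t - k0 * q' t / (l2 t)\<^sup>2"
    if "t \<in> I" for t
    using l1_DERIV[OF that] by (auto simp: real_differentiable_def DERIV_imp_deriv)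

  have c: "c i j = wronskian (\<lambda>s. column i (A s)) (\<lambda>s. column j (A s)) t"
    if "t \<in> I" "(i, j) \<in> {(1, 2), (1, 3), (1, 4), (2, 5), (2, 3), (2, 4),
      (3, 5), (3, 6), (4, 5), (4, 6), (5, 6)}" for i j t
    using Q_const that by (force simp: Q_eq_wronskian)
  have Q: "c 1 2 = wronskian (\<lambda>s. l1 s *\<^sub>R u s) u t"
      "c 1 3 = wronskian (\<lambda>s. l1 s *\<^sub>R u s) w t"
      "c 1 4 = wronskian (\<lambda>s. l1 s *\<^sub>R u s) (\<lambda>s. l2 s *\<^sub>R v s) t"
      "c 2 5 = wronskian u v t"
      "c 2 3 = wronskian u w t"
      "c 2 4 = wronskian u (\<lambda>s. l2 s *\<^sub>R v s) t"
      "c 3 5 = wronskian w v t"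
      "c 3 6 = wronskian w (\<lambda>s. (1 / l2 s) *\<^sub>R w s + l1 s *\<^sub>R v s) t"
      "c 4 5 = wronskian (\<lambda>s. l2 s *\<^sub>R v s) v t"
      "c 4 6 = wronskian (\<lambda>s. l2 s *\<^sub>R v s) (\<lambda>s. (1 / l2 s) *\<^sub>R w s + l1 s *\<^sub>R v s) t"
      "c 5 6 = wronskian v (\<lambda>s. (1 / l2 s) *\<^sub>R w s + l1 s *\<^sub>R v s) t"
    if t: "t \<in> I" for t
    by (subst c[OF t], blast, rule wronskian_cong[OF I(1) t];
        simp add: A1 A4 A6 u_def v_def w_def)+
  obtain d where d: "wronskian (\<lambda>s. l1 s *\<^sub>R u s) v t
      - wronskian u (\<lambda>s. (1 / l2 s) *\<^sub>R w s + l1 s *\<^sub>R v s) t = d" if "t \<in> I" for t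
  proof -
    obtain d where "Q A 1 5 t - Q A 2 6 t = d" if "t \<in> I" for t
      using Q_diff by (auto simp: constant_on_def)
    moreover have "Q A 1 5 t = wronskian (\<lambda>s. l1 s *\<^sub>R u s) v t"
      "Q A 2 6 t = wronskian u (\<lambda>s. (1 / l2 s) *\<^sub>R w s + l1 s *\<^sub>R v s) t" if t: "t \<in> I" for t
      unfolding Q_eq_wronskian
      by (rule wronskian_cong[OF I(1) t]; simp add: A1 A6 u_def v_def w_def)+
    ultimately show ?thesis
      by (intro that[of d]) simp
  qed
  \<comment> \<open>The hypotheses on \<open>Q\<close>, written out in the Gram matrix of \<open>u, v, w\<close>.\<close>
  have W: "(k2 * q' t - k0 * q' t / (l2 t)\<^sup>2) * (u t \<bullet> u t) = c 1 2"
      "(k2 * q' t - k0 * q' t / (l2 t)\<^sup>2) * (u t \<bullet> w t) + (k2 * l2 t + k1 + k0 / l2 t) * c 2 3 = c 1 3"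
      "(k2 * q' t - k0 * q' t / (l2 t)\<^sup>2) * (l2 t * (u t \<bullet> v t)) + (k2 * l2 t + k1 + k0 / l2 t) * c 2 4 = c 1 4"
      "l2 t * c 2 5 - q' t * (u t \<bullet> v t) = c 2 4"
      "2 * (k2 * q' t - k0 * q' t / (l2 t)\<^sup>2) * (u t \<bullet> v t) - c 2 3 / l2 t - q' t / (l2 t)\<^sup>2 * (u t \<bullet> w t) = d"
      "q' t / (l2 t)\<^sup>2 * (w t \<bullet> w t) + (k2 * l2 t + k1 + k0 / l2 t) * c 3 5
        - (k2 * q' t - k0 * q' t / (l2 t)\<^sup>2) * (w t \<bullet> v t) = c 3 6"
      "q' t * (v t \<bullet> v t) = c 4 5"
      "2 * q' t / l2 t * (w t \<bullet> v t) + (q' t * (k2 * l2 t + k1 + k0 / l2 t)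
        - l2 t * (k2 * q' t - k0 * q' t / (l2 t)\<^sup>2)) * (v t \<bullet> v t) - c 3 5 = c 4 6"
      "- c 3 5 / l2 t + q' t / (l2 t)\<^sup>2 * (w t \<bullet> v t)
        - (k2 * q' t - k0 * q' t / (l2 t)\<^sup>2) * (v t \<bullet> v t) = c 5 6"
    if t: "t \<in> I" for t
    using parabolic_wronskians[OF l1_diff[OF t] l2_diff[OF t] u_diff[OF t] v_diff[OF t] w_diff[OF t] nz'(3)[OF t],
        folded Q[OF t] q'_def, unfolded d[OF t] dl1[OF t] l1_eq[rule_format, OF t]]
    by simp_all

  have nonconst: "\<not> l2 constant_on I"
  proof
    assume "l2 constant_on I"
    then obtain y where "\<And>t. t \<in> I \<Longrightarrow> l2 t = y"
      by (auto simp: constant_on_def)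
    then have "column 1 (A t) = (k2 * y + k1 + k0 / y) *\<^sub>R column 2 (A t)" if "t \<in> I" for t
      using A1[OF that] that by (simp add: l1_eq u_def)
    then show False
      by (intro independent_columns_not_proportional[OF indep, of 1 2]) auto
  qed
  have l2_cont: "continuous_on I l2"
    using l2_DERIV by (auto intro!: continuous_at_imp_continuous_on DERIV_isCont)
  have inf: "infinite (l2 ` I)"
    by (rule infinite_image_if_nonconstant[OF conn l2_cont nonconst])
  have c45: "c 4 5 \<noteq> 0"
  proof
    assume "c 4 5 = 0"
    then have "q' t = 0" if "t \<in> I" for t
      using W(7)[OF that] vv_pos[OF that] by simp
    then have "l2 constant_on I"
      using l2_DERIV l2_cont
      by (intro DERIV_zero_connected_constant_on[OF conn I(1) finite.emptyI]) auto
    with nonconst show False ..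
  qed
  have q'_nz: "q' t \<noteq> 0" if "t \<in> I" for t
    using W(7)[OF that] c45 by auto
  have c12: "c 1 2 \<noteq> 0"
  proof
    assume "c 1 2 = 0"
    have "- k0 + 0 * x + k2 * x\<^sup>2 + 0 * x ^ 3 = 0" if "x \<in> l2 ` I" for x
    proof -
      from that obtain t where t: "t \<in> I" and x: "x = l2 t" by auto
      have "k2 * q' t - k0 * q' t / x\<^sup>2 = 0"
        using W(1)[OF t] uu_pos[OF t] \<open>c 1 2 = 0\<close> by (simp add: x)
      then show ?thesis
        using q'_nz[OF t] nz'(3)[OF t] by (simp add: x field_simps)
    qed
    then show False
      using cubic_coefficients_zero(1)[OF inf] k by fastforce
  qed

  have c25: "c 2 5 = 0" and c23: "c 2 3 = 0"
    and uv: "\<And>t. t \<in> I \<Longrightarrow> u t \<bullet> v t = 0" and uw: "\<And>t. t \<in> I \<Longrightarrow> u t \<bullet> w t = 0"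
    by (rule second_column_orthogonal[OF inf k nz'(3) q'_nz W(4) W(3) W(2) W(5)]; assumption)+
  have b15: "b15 t = 0" and b13: "b13 t = 0" if "t \<in> I" for t
    using uv[OF that] uw[OF that] nz'[OF that] rr[OF that]
    by (simp_all add: u[OF that] v[OF that] w[OF that] inner_add_right inner_diff_right)
  define k4 where "k4 = c 3 5 / c 4 5"
  have c35: "c 3 5 = k4 * c 4 5"
    using c45 by (simp add: k4_def)
  have wv: "w t \<bullet> v t = (k4 * l2 t - k0) * (v t \<bullet> v t)" if "t \<in> I" for t
    unfolding k4_def
    by (rule inner_third_fifth_column[OF inf nz'(3) c45 W(7) W(8) W(9) that]; assumption)
  define b33 where "b33 t = - 1 / (b12 t * b25 t)" for t
  have b33_nz: "b33 t \<noteq> 0" if "t \<in> I" for t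
    using nz'[OF that] by (simp add: b33_def)
  have v: "v t = b25 t *\<^sub>R r 2 t" if "t \<in> I" for t
    using v[OF that] b15[OF that] by simp
  have vv: "v t \<bullet> v t = (b25 t)\<^sup>2" if "t \<in> I" for t
    using rr[OF that] by (simp add: v[OF that] power2_eq_square)
  have b23: "b23 t = (k4 * l2 t - k0) * b25 t" if "t \<in> I" for t
    using wv[OF that] w[OF that] nz'(2)[OF that] rr[OF that]
    by (simp add: v[OF that] b13[OF that] inner_add_left inner_diff_left)
  have w: "w t = (k4 * l2 t - k0) *\<^sub>R v t + b33 t *\<^sub>R r 3 t" if "t \<in> I" for t
    using w[OF that] by (simp add: b13[OF that] b23[OF that] v[OF that] b33_def)

  \<comment> \<open>The coefficients of \<open>u, v, w\<close> in the frame \<open>r\<close> are inner products, hence differentiable.\<close>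
  have b12_diff: "b12 differentiable at t" and b25_diff: "b25 differentiable at t"
    and b33_diff: "b33 differentiable at t" if t: "t \<in> I" for t
  proof -
    show "b12 differentiable at t"
      by (rule differentiable_cong_open[OF differentiable_inner[OF u_diff[OF t] r_diff[OF t, of 1]] I(1) t])
         (simp add: u rr)
    show "b25 differentiable at t"
      by (rule differentiable_cong_open[OF differentiable_inner[OF v_diff[OF t] r_diff[OF t, of 2]] I(1) t])
         (simp add: v rr)
    show "b33 differentiable at t"
      by (rule differentiable_cong_open[OF differentiable_inner[OF w_diff[OF t] r_diff[OF t, of 3]] I(1) t])
         (simp add: w v rr inner_add_left)
  qed
  have r12: "wronskian (r 1) (r 2) t = 0" and r13: "wronskian (r 1) (r 3) t = 0"
    and r32: "wronskian (r 3) (r 2) t = 0" if t: "t \<in> I" for t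
  proof -
    \<comment> \<open>With \<open>w = g v + b33 r3\<close>, the part \<open>g v\<close> contributes nothing to \<open>[u, w]\<close>, and it
      contributes \<open>g' (v \<bullet> v) = k4 c45 = c35\<close>, hence everything, to \<open>[w, v]\<close>.\<close>
    define g where "g s = k4 * l2 s - k0" for s
    have "(g has_real_derivative k4 * q' t) (at t)"
      unfolding g_def by (auto intro!: derivative_eq_intros l2_DERIV[OF t])
    then have g_diff: "g differentiable at t" and dg: "deriv g t = k4 * q' t"
      by (auto simp: real_differentiable_def DERIV_imp_deriv)
    note diff = b12_diff[OF t] b25_diff[OF t] b33_diff[OF t] r_diff[OF t]
    have gv: "(\<lambda>s. g s *\<^sub>R v s) differentiable at t" and b33r: "(\<lambda>s. b33 s *\<^sub>R r 3 s) differentiable at t"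
      using g_diff v_diff[OF t] diff by (auto intro: differentiable_scaleR)
    have "wronskian u v t = wronskian (\<lambda>s. b12 s *\<^sub>R r 1 s) (\<lambda>s. b25 s *\<^sub>R r 2 s) t"
      by (rule wronskian_cong[OF I(1) t]) (simp_all add: u v)
    also have "\<dots> = b12 t * b25 t * wronskian (r 1) (r 2) t"
      using rr[OF t] diff by (intro wronskian_scaled_orthogonal) auto
    finally show "wronskian (r 1) (r 2) t = 0"
      using Q(4)[OF t] c25 nz'[OF t] by simp
    have "wronskian u (\<lambda>s. b33 s *\<^sub>R r 3 s) t = wronskian (\<lambda>s. b12 s *\<^sub>R r 1 s) (\<lambda>s. b33 s *\<^sub>R r 3 s) t"
      by (rule wronskian_cong[OF I(1) t]) (simp_all add: u)
    also have "\<dots> = b12 t * b33 t * wronskian (r 1) (r 3) t"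
      using rr[OF t] diff by (intro wronskian_scaled_orthogonal) auto
    finally have "wronskian u (\<lambda>s. b33 s *\<^sub>R r 3 s) t = b12 t * b33 t * wronskian (r 1) (r 3) t" .
    moreover have "wronskian u w t = wronskian u (\<lambda>s. g s *\<^sub>R v s + b33 s *\<^sub>R r 3 s) t"
      by (rule wronskian_cong[OF I(1) t]) (simp_all add: w g_def)
    then have "wronskian u w t = wronskian u (\<lambda>s. b33 s *\<^sub>R r 3 s) t"
      using Q(4)[OF t] c25 uv[OF t]
      by (simp add: wronskian_add_right[OF gv b33r] wronskian_scaleR_right[OF g_diff v_diff[OF t]])
    ultimately show "wronskian (r 1) (r 3) t = 0"
      using Q(5)[OF t] c23 nz'[OF t] b33_nz[OF t] by simp
    have "wronskian (\<lambda>s. b33 s *\<^sub>R r 3 s) v t = wronskian (\<lambda>s. b33 s *\<^sub>R r 3 s) (\<lambda>s. b25 s *\<^sub>R r 2 s) t"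
      by (rule wronskian_cong[OF I(1) t]) (simp_all add: v)
    also have "\<dots> = b33 t * b25 t * wronskian (r 3) (r 2) t"
      using rr[OF t] diff by (intro wronskian_scaled_orthogonal) auto
    finally have "wronskian (\<lambda>s. b33 s *\<^sub>R r 3 s) v t = b33 t * b25 t * wronskian (r 3) (r 2) t" .
    moreover have "wronskian w v t = wronskian (\<lambda>s. g s *\<^sub>R v s + b33 s *\<^sub>R r 3 s) v t"
      by (rule wronskian_cong[OF I(1) t]) (simp_all add: w g_def)
    then have "wronskian w v t = k4 * (q' t * (v t \<bullet> v t)) + wronskian (\<lambda>s. b33 s *\<^sub>R r 3 s) v t"
      by (simp add: wronskian_add_left[OF gv b33r] wronskian_scaleR_left[OF g_diff v_diff[OF t]] dg)
    ultimately show "wronskian (r 3) (r 2) t = 0"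
      using Q(7)[OF t] c35 W(7)[OF t] nz'[OF t] b33_nz[OF t] by simp
  qed
  have R_const: "R constant_on I"
  proof (rule orthogonal_path_constant_if_wronskians_zero[OF I(1) conn _ R_orth])
    fix i j :: 3 and t assume t: "t \<in> I"
    show "(\<lambda>s. column i (R s)) differentiable at t"
      using r_diff[OF t] by (simp add: r_def[abs_def])
    have "wronskian (r i) (r j) t = 0"
      using exhaust_3[of i] exhaust_3[of j] r12[OF t] r13[OF t] r32[OF t]
        wronskian_swap[of "r 2" "r 1" t] wronskian_swap[of "r 3" "r 1" t] wronskian_swap[of "r 2" "r 3" t]
      by auto
    then show "wronskian (\<lambda>s. column i (R s)) (\<lambda>s. column j (R s)) t = 0"
      by (simp add: r_def[abs_def])
  qed assumption

  define k3 where "k3 = - c 1 2 * c 4 5 * (c 3 6 - c 4 5 * (k4\<^sup>2 + k1 * k4 + k0 * k2))"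
  have uu: "u t \<bullet> u t = (b12 t)\<^sup>2" if "t \<in> I" for t
    using rr[OF that] by (simp add: u[OF that] power2_eq_square)
  have ww: "w t \<bullet> w t = (k4 * l2 t - k0)\<^sup>2 * (b25 t)\<^sup>2 + 1 / ((b12 t)\<^sup>2 * (b25 t)\<^sup>2)" if "t \<in> I" for t
    using rr[OF that]
    by (simp add: w[OF that] v[OF that] b33_def inner_diff_left inner_diff_right power2_eq_square mult_ac)
  have sol: "k3 \<noteq> 0" "k0 - k2 * (l2 t)\<^sup>2 \<noteq> 0"
    "(q' t) ^ 3 = k3 * (l2 t) ^ 4 / (k0 - k2 * (l2 t)\<^sup>2)"
    "(b25 t) ^ 6 = (c 4 5) ^ 3 * (k0 - k2 * (l2 t)\<^sup>2) / (k3 * (l2 t) ^ 4)"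
    "(b12 t)\<^sup>2 = - (c 1 2 * (b25 t)\<^sup>2 * (l2 t)\<^sup>2) / (c 4 5 * (k0 - k2 * (l2 t)\<^sup>2))"
    if t: "t \<in> I" for t
    using reduced_system_solution[OF nz'[OF t] c12 c45 W(1)[OF t, unfolded uu[OF t]] W(7)[OF t, unfolded vv[OF t]]
        W(6)[OF t, unfolded wv[OF t] vv[OF t] ww[OF t] c35] k3_def]
    by simp_all
  obtain t0 where "t0 \<in> I"
    using inf by fastforce
  then have "k3 \<noteq> 0"
    by (rule sol(1))
  then show ?thesis
    using R_const c45 sol(2-5) b13 b15 b23 l1_eq unfolding q'_def by blast
qed

end
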